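(* Let $V$ be a locally linearly compact vector space over a discrete finite field $\mathbb{F}$ and $\phi:V\to V$ a continuous endomorphism. Then $$h_{top}(\phi)=\mathrm{ent}^*(\phi)\cdot\log|\mathbb{F}|.$$
   Context: Let $\mathbb{F}$ be a finite field with the discrete topology. A Hausdorff topological $\mathbb{F}$-vector space is linearly topologized if it has a neighborhood basis at $0$ consisting of linear subspaces. A linear variety is a coset $v+W$ of a linear subspace $W$; it is closed if $W$ is closed. A linearly topologized vector space is linearly compact if every collection of closed linear varieties with the finite intersection property has non-empty intersection. A topological $\mathbb{F}$-vector space $V$ is locally linearly compact if it has a neighborhood basis at $0$ consisting of linearly compact open linear subspaces; $\mathcal{B}(V)$ denotes the set of all linearly compact open linear subspaces of $V$. A continuous endomorphism of $V$ is a continuous $\mathbb{F}$-linear map $V\to V$. Such a $V$ (over a finite field) is in particular a totally disconnected locally compact abelian group. For a subset $F$ of $V$ and $n\geq 1$ let $C_n(\phi,F)=F\cap\phi^{-1}F\cap\ldots\cap\phi^{-n+1}F$. For $U\in\mathcal{B}(V)$, $H^*(\phi,U)=\lim_{n\to\infty}\frac{1}{n}\dim\frac{U}{C_n(\phi,U)}$ (this limit exists) and $\mathrm{ent}^*(\phi)=\sup\{H^*(\phi,U)\mid U\in\mathcal{B}(V)\}$. For a totally disconnected locally compact group $G$ and a continuous group endomorphism $\phi:G\to G$, let $\mathcal{B}_{gr}(G)=\{U\leq G\mid U\text{ a compact open subgroup}\}$, $H_{top}(\phi,U)=\lim_{n\to\infty}\frac{1}{n}\log[U:C_n(\phi,U)]$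 for $U\in\mathcal{B}_{gr}(G)$, and $h_{top}(\phi)=\sup\{H_{top}(\phi,U)\mid U\in\mathcal{B}_{gr}(G)\}$. In the claim, $h_{top}(\phi)$ is computed for $V$ regarded as a totally disconnected locally compact abelian group. *)

theory Defs
  imports "HOL-Analysis.Analysis" "HOL-Algebra.Coset" "HOL-Algebra.Module"
begin

definition cotrajectory :: "('a \<Rightarrow> 'a) \<Rightarrow> 'a set \<Rightarrow> nat \<Rightarrow> 'a set" where
  "cotrajectory \<phi> F n = (\<Inter>i<n. (\<phi> ^^ i) -` F)"  \<comment> \<open>\<open>C\<^sub>n(\<phi>, F)\<close>, for \<open>n \<ge> 1\<close>\<close>

definition group_of_type :: "'a::group_add monoid" where
  "group_of_type = \<lparr>carrier = UNIV, mult = (+), one = 0\<rparr>"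


subsection \<open>Topological entropy on topological groups\<close>

definition B_gr :: "'a::topological_group_add set set" where
  "B_gr = {U. subgroup U group_of_type \<and> compact U \<and> open U}"

text \<open>All indices below are finite when \<open>U\<close> is a compact open subgroup and \<open>\<phi>\<close> is a
  continuous endomorphism, so the value \<open>0\<close> of \<^const>\<open>card\<close> on infinite sets plays no role.\<close>

definition group_index :: "'a::group_add set \<Rightarrow> 'a set \<Rightarrow> nat" where
  "group_index U C = card (rcosets\<^bsub>group_of_type\<lparr>carrier := U\<rparr>\<^esub> C)"

definition H_top :: "('a::topological_group_add \<Rightarrow> 'a) \<Rightarrow> 'a set \<Rightarrow> real" where
  "H_top \<phi> U = lim (\<lambda>n. ln (real (group_index U (cotrajectory \<phi> U n))) / real n)"

definition h_top :: "('a::topological_group_add \<Rightarrow> 'a) \<Rightarrow> ereal" where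
  "h_top \<phi> = (SUP U\<in>B_gr. ereal (H_top \<phi> U))"


subsection \<open>Dimension of a carrier-based vector space\<close>

text \<open>The scalars are all of a type \<open>'f\<close>; the vectors form the carrier of a
  \<^type>\<open>module\<close> record, whose multiplicative components are ignored.\<close>

definition lincomb :: "('f::field, 'b) module \<Rightarrow> ('b \<Rightarrow> 'f) \<Rightarrow> 'b set \<Rightarrow> 'b" where
  "lincomb M c S = finsum M (\<lambda>x. c x \<odot>\<^bsub>M\<^esub> x) S"

definition is_basis :: "('f::field, 'b) module \<Rightarrow> 'b set \<Rightarrow> bool" where
  "is_basis M B \<longleftrightarrow> B \<subseteq> carrier M \<and>
     (\<forall>S c. finite S \<and> S \<subseteq> B \<and> lincomb M c S = \<zero>\<^bsub>M\<^esub> \<longrightarrow> (\<forall>x\<in>S. c x = 0)) \<and>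
     (\<forall>v\<in>carrier M. \<exists>S c. finite S \<and> S \<subseteq> B \<and> v = lincomb M c S)"

text \<open>As for the library's \<open>dim\<close>, the value is \<open>0\<close> if the space is infinite-dimensional.\<close>

definition vdim :: "('f::field, 'b) module \<Rightarrow> nat" where
  "vdim M = card (SOME B. is_basis M B)"


subsection \<open>Linearly topologized vector spaces over a discrete field\<close>

text \<open>Hausdorffness is not part of this locale; it enters with linear topologies below.\<close>

locale topological_vector_space = vector_space scale
  for scale :: "'f::field \<Rightarrow> 'v::topological_ab_group_add \<Rightarrow> 'v" +
  assumes continuous_scale:
    "continuous_map (prod_topology (discrete_topology UNIV) euclidean) euclidean
       (\<lambda>(a, v). scale a v)"
begin

text \<open>The following three notions concern a linear subspace \<open>W\<close>, seen as a topological
  vector space in its own right with the subspace topology.\<close>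

definition linearly_topologized :: "'v set \<Rightarrow> bool" where
  "linearly_topologized W \<longleftrightarrow> subspace W \<and> Hausdorff_space (top_of_set W) \<and>
     neighbourhood_base_at 0 subspace (top_of_set W)"

definition closed_linear_variety :: "'v set \<Rightarrow> 'v set \<Rightarrow> bool" where
  "closed_linear_variety W A \<longleftrightarrow>
     (\<exists>v\<in>W. \<exists>S. subspace S \<and> S \<subseteq> W \<and> closedin (top_of_set W) S \<and> A = (+) v ` S)"

definition linearly_compact :: "'v set \<Rightarrow> bool" where
  "linearly_compact W \<longleftrightarrow> linearly_topologized W \<and>
     (\<forall>\<C>. (\<forall>A\<in>\<C>. closed_linear_variety W A) \<and>
          (\<forall>\<F>. finite \<F> \<and> \<F> \<subseteq> \<C> \<longrightarrow> \<Inter>\<F> \<noteq> {}) \<longrightarrow> \<Inter>\<C> \<noteq> {})"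

definition B_lin :: "'v set set" where
  "B_lin = {U. subspace U \<and> linearly_compact U \<and> open U}"

text \<open>The vector space \<open>U / W\<close>: the factor group of cosets, where \<open>c (u + W) = c u + W\<close>.
  The outer \<open>+ W\<close> in the scalar multiplication matters for \<open>c = 0\<close>.\<close>

definition quotient_space :: "'v set \<Rightarrow> 'v set \<Rightarrow> ('f, 'v set) module" where
  "quotient_space U W =
     (let Q = group_of_type\<lparr>carrier := U\<rparr> Mod W in
      \<lparr>carrier = carrier Q, mult = undefined, one = undefined,
       zero = one Q, add = mult Q, smult = (\<lambda>c A. {scale c a + w | a w. a \<in> A \<and> w \<in> W})\<rparr>)"

text \<open>For \<open>U \<in> B_lin\<close> and a continuous endomorphism \<open>\<phi>\<close> the quotients are
  finite-dimensional: open subspaces of linearly compact spaces have finite codimension.\<close>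

definition H_star :: "('v \<Rightarrow> 'v) \<Rightarrow> 'v set \<Rightarrow> real" where
  "H_star \<phi> U = lim (\<lambda>n. real (vdim (quotient_space U (cotrajectory \<phi> U n))) / real n)"

definition ent_star :: "('v \<Rightarrow> 'v) \<Rightarrow> ereal" where
  "ent_star \<phi> = (SUP U\<in>B_lin. ereal (H_star \<phi> U))"

end

locale locally_linearly_compact_space = topological_vector_space +
  assumes linearly_compact_base: "neighbourhood_base_at 0 (\<lambda>U. U \<in> B_lin) euclidean"

end

theory Submission
  imports Defs "HOL-Real_Asymp.Real_Asymp"
begin

text \<open>Over a finite field a linearly compact open subspace \<open>U\<close> is a compact open subgroup and
  \<open>[U : C\<^sub>n(\<phi>, U)]\<close> is the power of \<open>|F|\<close> with exponent \<open>dim (U / C\<^sub>n(\<phi>, U))\<close>, so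
  \<open>H_top \<phi> U = H_star \<phi> U * ln |F|\<close>. Since \<open>H_top \<phi>\<close> is antimonotone in the subgroup and the
  linearly compact open subspaces form a base at \<open>0\<close>, they are cofinal among the compact open
  subgroups and compute the same supremum.\<close>

subsection \<open>Indices of subgroups\<close>

text \<open>\<open>lim\<close> and the basis behind \<open>vdim\<close> are choices, so existence
  must be settled before either entropy means anything. Convergence is proved once, for all compact
  open subgroups, because indices are natural numbers, and is then carried over to dimensions. The
  exponent of |F| is found by counting the vectors of a finite quotient against a basis of it. The
  other obstacle is compactness: linear compactness speaks of closed linear varieties only, while
  arbitrary open covers have to be refined. The bridge is that open subspaces have finite index. It
  comes from asking for a vector all of whose coordinates outside a basis of the subspace equal 1:
  finitely many of these conditions are always solvable, infinitely many never are, since vectors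
  have finite support.\<close>

lemma subgroup_group_of_type_iff:
  fixes C :: "'a::ab_group_add set"
  shows "subgroup C group_of_type \<longleftrightarrow> 0 \<in> C \<and> (\<forall>x\<in>C. \<forall>y\<in>C. x - y \<in> C)"
proof -
  have inv_eq: "inv\<^bsub>group_of_type\<^esub> x = - x" for x :: 'a
    unfolding m_inv_def group_of_type_def
    by (rule the_equality) (auto simp: eq_neg_iff_add_eq_0)
  show ?thesis
  proof (intro iffI conjI ballI)
    assume C: "subgroup C group_of_type"
    show "0 \<in> C" using subgroup.one_closed[OF C] by (simp add: group_of_type_def)
    fix x y assume "x \<in> C" "y \<in> C"
    then show "x - y \<in> C"
      using subgroup.m_closed[OF C, of x "- y"] subgroup.m_inv_closed[OF C, of y]
      by (simp add: inv_eq) (simp add: group_of_type_def)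
  next
    assume C: "0 \<in> C \<and> (\<forall>x\<in>C. \<forall>y\<in>C. x - y \<in> C)"
    then have um: "- x \<in> C" if "x \<in> C" for x using that by (metis diff_0)
    then have "x + y \<in> C" if "x \<in> C" "y \<in> C" for x y
      using that C by (metis diff_minus_eq_add)
    with C um show "subgroup C group_of_type"
      by unfold_locales (simp_all add: inv_eq, simp_all add: group_of_type_def)
  qed
qed

lemma coset_eq_iff:
  fixes C :: "'a::ab_group_add set"
  assumes "subgroup C group_of_type"
  shows "(+) x ` C = (+) y ` C \<longleftrightarrow> x - y \<in> C"
proof
  note C = assms[unfolded subgroup_group_of_type_iff]
  {
    assume "(+) x ` C = (+) y ` C"
    moreover have "x + 0 \<in> (+) x ` C" using C by blast
    ultimately obtain c where "x = y + c" "c \<in> C" by auto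
    then show "x - y \<in> C" by simp
  next
    assume xy: "x - y \<in> C"
    have um: "- c \<in> C" if "c \<in> C" for c using that C by (metis diff_0)
    have sub: "(+) a ` C \<subseteq> (+) b ` C" if "a - b \<in> C" for a b
    proof
      fix z assume "z \<in> (+) a ` C"
      then obtain c where c: "c \<in> C" "z = a + c" by auto
      have "(a - b) - (- c) \<in> C" using that um[OF c(1)] C by blast
      moreover have "z = b + ((a - b) - (- c))" using c by simp
      ultimately show "z \<in> (+) b ` C" by blast
    qed
    show "(+) x ` C = (+) y ` C"
      using sub[OF xy] sub[of y x] um[OF xy] by auto
  }
qed

text \<open>Commutativity turns right cosets into translates, so indices become cardinalities of
  images of the single map x to x + C on U.\<close>

lemma rcosets_group_of_type:
  fixes U C :: "'a::ab_group_add set"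
  shows "rcosets\<^bsub>group_of_type\<lparr>carrier := U\<rparr>\<^esub> C = (\<lambda>x. (+) x ` C) ` U"
  unfolding RCOSETS_def r_coset_def group_of_type_def
  by (auto simp: add.commute image_iff)

lemma group_index_eq_card_image:
  fixes U C :: "'a::ab_group_add set"
  shows "group_index U C = card ((\<lambda>x. (+) x ` C) ` U)"
  by (simp add: group_index_def rcosets_group_of_type)

text \<open>Both images are the quotient of \<open>A\<close> by the same equivalence relation. This
  replaces isomorphism theorems wherever only the number of cosets matters.\<close>

lemma card_image_same_kernel:
  assumes "\<And>x y. x \<in> A \<Longrightarrow> y \<in> A \<Longrightarrow> f x = f y \<longleftrightarrow> g x = g y"
  shows "card (f ` A) = card (g ` A)"
proof (rule bij_betw_same_card)
  have *: "g (SOME y. y \<in> A \<and> f y = f x) = g x" if "x \<in> A" for x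
    by (rule someI2[of _ x]) (use assms that in auto)
  then show "bij_betw (\<lambda>z. g (SOME x. x \<in> A \<and> f x = z)) (f ` A) (g ` A)"
    using assms by (auto simp: bij_betw_def inj_on_def image_image)
qed

text \<open>Sort the cosets of D in U by the coset of C containing them: each of the [U : C] classes
  is a translate of the set of cosets of D in C. Finiteness keeps \<open>card\<close> away from its
  default value 0.\<close>

lemma group_index_mult:
  fixes U C D :: "'a::ab_group_add set"
  assumes U: "subgroup U group_of_type" and C: "subgroup C group_of_type"
    and D: "subgroup D group_of_type"
    and sub: "D \<subseteq> C" "C \<subseteq> U"
    and fin: "finite ((\<lambda>x. (+) x ` D) ` U)"
  shows "group_index U D = group_index U C * group_index C D"
proof -
  define q where "q E x = (+) x ` E" for E :: "'a set" and x
  note q_eq = coset_eq_iff[OF C, folded q_def] coset_eq_iff[OF D, folded q_def]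
  note Us = U[unfolded subgroup_group_of_type_iff]
  note Cs = C[unfolded subgroup_group_of_type_iff]
  have finD: "finite (q D ` U)" using fin by (simp add: q_def[abs_def])
  have eqU: "q D ` U = (\<Union>A\<in>q C ` U. q D ` {x\<in>U. q C x = A})" by auto
  have "card (q D ` U) = (\<Sum>A\<in>q C ` U. card (q D ` {x\<in>U. q C x = A}))"
  proof (subst eqU, rule card_UN_disjoint)
    \<comment> \<open>\<open>h\<close> sends a coset of D to the coset of C containing it,
      independently of the representative since D \<subseteq> C. It yields both the finiteness of
      the index set and the disjointness of the classes.\<close>
    define h where "h Z = q C (SOME x. x \<in> U \<and> q D x = Z)" for Z
    have h: "h (q D x) = q C x" if "x \<in> U" for x
      unfolding h_def by (rule someI2[of _ x]) (use that q_eq sub in auto)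
    have "q C ` U = h ` (q D ` U)" using h by (auto simp: image_image)
    then show "finite (q C ` U)" using finD by simp
    show "\<forall>A\<in>q C ` U. finite (q D ` {x \<in> U. q C x = A})"
      using finD by (auto intro: finite_subset)
    show "\<forall>A\<in>q C ` U. \<forall>B\<in>q C ` U. A \<noteq> B \<longrightarrow>
        q D ` {x \<in> U. q C x = A} \<inter> q D ` {x \<in> U. q C x = B} = {}"
    proof (intro ballI impI)
      fix A B :: "'a set" assume "A \<noteq> B"
      show "q D ` {x \<in> U. q C x = A} \<inter> q D ` {x \<in> U. q C x = B} = {}"
      proof (rule equals0I)
        fix Z assume "Z \<in> q D ` {x \<in> U. q C x = A} \<inter> q D ` {x \<in> U. q C x = B}"
        then have "h Z = A" "h Z = B" using h by auto
        then show False using \<open>A \<noteq> B\<close> by simp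
      qed
    qed
  qed
  also have "\<dots> = (\<Sum>A\<in>q C ` U. card (q D ` C))"
  proof (rule sum.cong)
    fix A assume "A \<in> q C ` U"
    then obtain u where u: "u \<in> U" "A = q C u" by auto
    have um: "- c \<in> C" if "c \<in> C" for c using that Cs by (metis diff_0)
    have fib: "{x\<in>U. q C x = A} = (+) u ` C"
    proof
      show "{x \<in> U. q C x = A} \<subseteq> (+) u ` C"
        using u q_eq by (auto intro!: image_eqI[of _ _ "x - u" for x])
      have "u - (- c) \<in> U" if "c \<in> C" for c
        using Us u(1) um[OF that] sub by blast
      then show "(+) u ` C \<subseteq> {x \<in> U. q C x = A}"
        using u q_eq by auto
    qed
    \<comment> \<open>Translating by \<open>u\<close> does not affect which elements agree modulo
      D.\<close>
    have "card (q D ` (+) u ` C) = card (q D ` C)"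
      unfolding image_image by (rule card_image_same_kernel) (simp add: q_eq)
    then show "card (q D ` {x\<in>U. q C x = A}) = card (q D ` C)"
      by (simp add: fib)
  qed simp
  finally show ?thesis
    by (simp add: group_index_eq_card_image q_def[abs_def])
qed

lemma open_coset:
  fixes W :: "'a::topological_ab_group_add set"
  assumes "open W"
  shows "open ((+) x ` W)"
proof -
  have "(+) x ` W = (\<lambda>z. z - x) -` W"
    by (auto intro!: image_eqI[of _ _ "z - x" for z])
  moreover have "open ((\<lambda>z. z - x) -` W)"
    by (intro open_vimage assms continuous_intros)
  ultimately show ?thesis by simp
qed

text \<open>The translates of C by points of U are an open cover of U, and the points that give a
  finite subcover represent every coset.\<close>

lemma finite_cosets_compact_open:
  fixes U C :: "'a::topological_ab_group_add set"
  assumes "compact U" "open C" and C: "subgroup C group_of_type"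
  shows "finite ((\<lambda>x. (+) x ` C) ` U)"
proof -
  have "0 \<in> C" using C by (simp add: subgroup_group_of_type_iff)
  have "U \<subseteq> (\<Union>x\<in>U. (+) x ` C)" using \<open>0 \<in> C\<close> by force
  then obtain F where F: "F \<subseteq> U" "finite F" "U \<subseteq> (\<Union>x\<in>F. (+) x ` C)"
    using compactE_image[OF \<open>compact U\<close>, of U "\<lambda>x. (+) x ` C"] open_coset[OF \<open>open C\<close>] by metis
  have "(\<lambda>x. (+) x ` C) ` U \<subseteq> (\<lambda>x. (+) x ` C) ` F"
  proof clarify
    fix x assume "x \<in> U"
    then obtain y c where "y \<in> F" "c \<in> C" "x = y + c" using F by auto
    then show "(+) x ` C \<in> (\<lambda>x. (+) x ` C) ` F"
      using coset_eq_iff[OF C, of x y] by auto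
  qed
  then show ?thesis using F finite_subset by blast
qed

text \<open>The fibres on A of the map x to \<phi> x + D are exactly the cosets counted on the left,
  so \<phi> induces an injection into B / D.\<close>

lemma group_index_vimage_le:
  fixes A B D :: "'a::ab_group_add set"
  assumes "Modules.additive \<phi>" and A: "subgroup A group_of_type" and D: "subgroup D group_of_type"
    and "\<phi> ` A \<subseteq> B" and fin: "finite ((\<lambda>x. (+) x ` D) ` B)"
  shows "group_index A (A \<inter> \<phi> -` D) \<le> group_index B D"
proof -
  interpret additive \<phi> by fact
  have AD: "subgroup (A \<inter> \<phi> -` D) group_of_type"
    using A D unfolding subgroup_group_of_type_iff by (auto simp: zero diff)
  have "card ((\<lambda>x. (+) x ` (A \<inter> \<phi> -` D)) ` A) = card ((\<lambda>x. (+) (\<phi> x) ` D) ` A)"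
    using A by (intro card_image_same_kernel)
      (auto simp: coset_eq_iff[OF AD] coset_eq_iff[OF D] diff subgroup_group_of_type_iff)
  also have "\<dots> \<le> card ((\<lambda>x. (+) x ` D) ` B)"
    using assms(4) by (intro card_mono fin) auto
  finally show ?thesis by (simp add: group_index_eq_card_image)
qed

lemma group_index_pos:
  fixes U C :: "'a::ab_group_add set"
  assumes "finite ((\<lambda>x. (+) x ` C) ` U)" "U \<noteq> {}"
  shows "group_index U C > 0"
  using assms by (simp add: group_index_eq_card_image card_gt_0_iff)

subsection \<open>Existence of the limits\<close>

text \<open>A non-increasing sequence of naturals is eventually constant, so \<open>b\<close> is
  eventually geometric with some ratio \<alpha> and the averages tend to ln \<alpha>. The hypotheses
  start at n = 1 because \<open>cotrajectory\<close> at 0 is \<open>UNIV\<close>, which need not lie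
  in the subgroup whose index is taken.\<close>

lemma ln_average_convergent:
  fixes a b :: "nat \<Rightarrow> nat"
  assumes step: "\<And>n. n \<ge> 1 \<Longrightarrow> b (Suc n) = b n * a n"
    and anti: "\<And>n. n \<ge> 1 \<Longrightarrow> a (Suc n) \<le> a n"
    and pos: "\<And>n. n \<ge> 1 \<Longrightarrow> b n > 0"
  shows "convergent (\<lambda>n. ln (real (b n)) / real n)"
proof -
  define \<alpha> where "\<alpha> = (LEAST k. \<exists>n\<ge>1. a n = k)"
  have "\<exists>n\<ge>1. a n = \<alpha>" unfolding \<alpha>_def by (rule LeastI[of _ "a 1"]) auto
  then obtain N where N: "N \<ge> 1" "a N = \<alpha>" by blast
  have const: "a (N + k) = \<alpha>" for k
  proof (rule antisym)
    show "a (N + k) \<le> \<alpha>"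
      by (induction k) (use N in \<open>auto intro: order_trans[OF anti]\<close>)
    show "\<alpha> \<le> a (N + k)"
      unfolding \<alpha>_def using N by (intro Least_le exI[of _ "N + k"]) auto
  qed
  have bN: "b (N + k) = b N * \<alpha> ^ k" for k
    by (induction k) (use step N const in \<open>auto simp: algebra_simps\<close>)
  \<comment> \<open>A zero ratio would make \<open>b (N + 1)\<close> vanish.\<close>
  have "\<alpha> > 0" using pos[of "N + 1"] bN[of 1] by simp
  then have ln_b: "ln (real (b (N + k))) = ln (real (b N)) + real k * ln (real \<alpha>)" for k
    using pos[of N] N by (simp add: bN ln_mult ln_realpow)
  have "(\<lambda>k. (ln (real (b N)) + real k * ln (real \<alpha>)) / real (N + k)) \<longlonglongrightarrow> ln (real \<alpha>)"
    by real_asymp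
  then have "(\<lambda>k. ln (real (b (k + N))) / real (k + N)) \<longlonglongrightarrow> ln (real \<alpha>)"
    by (simp add: ln_b add.commute[of _ N])
  then show ?thesis
    using LIMSEQ_offset[of "\<lambda>n. ln (real (b n)) / real n"] convergentI by blast
qed

section \<open>Cotrajectories of subgroups and of open sets\<close>

lemma cotrajectory_Suc: "cotrajectory \<phi> F (Suc n) = cotrajectory \<phi> F n \<inter> (\<phi> ^^ n) -` F"
  by (auto simp: cotrajectory_def less_Suc_eq)

text \<open>Splitting off the first condition instead of the last shows that \<phi> maps each
  cotrajectory into the previous one, and suits inductions that take preimages.\<close>

lemma cotrajectory_Suc': "cotrajectory \<phi> F (Suc n) = F \<inter> \<phi> -` cotrajectory \<phi> F n"
proof -
  have "{..<Suc n} = insert 0 (Suc ` {..<n})" by (simp add: lessThan_Suc_eq_insert_0)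
  then show ?thesis
    unfolding cotrajectory_def by (auto simp: funpow_swap1 simp del: funpow.simps(2)
        simp add: funpow_Suc_right)
qed

lemma cotrajectory_mono: "F \<subseteq> G \<Longrightarrow> cotrajectory \<phi> F n \<subseteq> cotrajectory \<phi> G n"
  by (auto simp: cotrajectory_def)

lemma cotrajectory_subset: "n \<ge> 1 \<Longrightarrow> cotrajectory \<phi> F n \<subseteq> F"
  by (cases n) (auto simp: cotrajectory_Suc')

lemma cotrajectory_Suc_subset: "cotrajectory \<phi> F (Suc n) \<subseteq> cotrajectory \<phi> F n"
  by (auto simp: cotrajectory_Suc)

lemma subgroup_cotrajectory:
  fixes U :: "'a::ab_group_add set"
  assumes "Modules.additive \<phi>" "subgroup U group_of_type"
  shows "subgroup (cotrajectory \<phi> U n) group_of_type"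
proof (induction n)
  case 0
  show ?case by (simp add: cotrajectory_def subgroup_group_of_type_iff)
next
  case (Suc n)
  interpret additive \<phi> by fact
  show ?case
    using Suc assms(2) unfolding cotrajectory_Suc' subgroup_group_of_type_iff
    by (auto simp: zero diff)
qed

lemma open_cotrajectory:
  fixes U :: "'a::topological_space set"
  assumes "continuous_on UNIV \<phi>" "open U"
  shows "open (cotrajectory \<phi> U n)"
proof (induction n)
  case (Suc n)
  then show ?case
    unfolding cotrajectory_Suc' using assms by (intro open_Int open_vimage) auto
qed (simp add: cotrajectory_def)

section \<open>Entropy at compact open subgroups: convergence and monotonicity\<close>

context
  fixes \<phi> :: "'v::topological_ab_group_add \<Rightarrow> 'v"
  assumes additive: "Modules.additive \<phi>" and continuous: "continuous_on UNIV \<phi>"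
begin

lemma finite_cosets_cotrajectory:
  assumes "U \<in> B_gr" "W \<in> B_gr"
  shows "finite ((\<lambda>x. (+) x ` cotrajectory \<phi> W n) ` U)"
  using assms additive continuous
  by (auto simp: B_gr_def intro!: finite_cosets_compact_open open_cotrajectory subgroup_cotrajectory)

lemma group_index_cotrajectory_pos:
  assumes "U \<in> B_gr" "W \<in> B_gr"
  shows "group_index U (cotrajectory \<phi> W n) > 0"
  using assms finite_cosets_cotrajectory[OF assms]
  by (intro group_index_pos) (auto simp: B_gr_def subgroup_group_of_type_iff)

text \<open>\<open>\<phi>\<close> induces an injection of \<open>C\<^sub>n\<^sub>+\<^sub>1/C\<^sub>n\<^sub>+\<^sub>2\<close> into \<open>C\<^sub>n/C\<^sub>n\<^sub>+\<^sub>1\<close>, so these indices are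
  eventually constant.\<close>

lemma convergent_H_top:
  assumes U: "U \<in> B_gr"
  shows "convergent (\<lambda>n. ln (real (group_index U (cotrajectory \<phi> U n))) / real n)"
proof -
  let ?C = "cotrajectory \<phi> U"
  have sg: "subgroup U group_of_type" using U by (simp add: B_gr_def)
  have sgC: "subgroup (?C n) group_of_type" for n
    by (rule subgroup_cotrajectory[OF additive sg])
  show ?thesis
  proof (rule ln_average_convergent[where a = "\<lambda>n. group_index (?C n) (?C (Suc n))"])
    fix n :: nat assume n: "n \<ge> 1"
    then have CU: "?C n \<subseteq> U" by (rule cotrajectory_subset)
    show "group_index U (?C (Suc n)) = group_index U (?C n) * group_index (?C n) (?C (Suc n))"
      by (rule group_index_mult[OF sg sgC sgC cotrajectory_Suc_subset CU
            finite_cosets_cotrajectory[OF U U]])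
    have "finite ((\<lambda>x. (+) x ` ?C (Suc n)) ` ?C n)"
      using finite_cosets_cotrajectory[OF U U] CU by (meson finite_subset image_mono)
    moreover have "\<phi> ` ?C (Suc n) \<subseteq> ?C n" by (auto simp: cotrajectory_Suc')
    \<comment> \<open>Since C_{n+1} lies in C_n, the points of U that \<phi> sends into C_{n+1} are
      already in C_{n+1}. This is the shape of \<open>group_index_vimage_le\<close> with A = D =
      C_{n+1} and B = C_n.\<close>
    moreover have "?C (Suc (Suc n)) = ?C (Suc n) \<inter> \<phi> -` ?C (Suc n)"
      unfolding cotrajectory_Suc'[of _ _ "Suc n"]
      using cotrajectory_Suc_subset[of \<phi> U n] by (auto simp: cotrajectory_Suc'[of _ _ n])
    ultimately show "group_index (?C (Suc n)) (?C (Suc (Suc n))) \<le> group_index (?C n) (?C (Suc n))"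
      using group_index_vimage_le[OF additive sgC sgC] by simp
  qed (rule group_index_cotrajectory_pos[OF U U])
qed

lemma H_top_LIMSEQ:
  "U \<in> B_gr \<Longrightarrow> (\<lambda>n. ln (real (group_index U (cotrajectory \<phi> U n))) / real n) \<longlonglongrightarrow> H_top \<phi> U"
  unfolding H_top_def by (rule convergent_LIMSEQ_iff[THEN iffD1, OF convergent_H_top])

text \<open>[U : C_n(U)] is at most [U : C_n(W)] = [U : W] [W : C_n(W)], and the factor [U : W] does
  not depend on n, so its logarithm disappears after division by n.\<close>

lemma H_top_antimono:
  assumes U: "U \<in> B_gr" and W: "W \<in> B_gr" and "W \<subseteq> U"
  shows "H_top \<phi> U \<le> H_top \<phi> W"
proof -
  let ?C = "cotrajectory \<phi>"
  let ?k = "group_index U W"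
  have sg: "subgroup U group_of_type" "subgroup W group_of_type"
    using U W by (simp_all add: B_gr_def)
  have sgC: "subgroup (?C U n) group_of_type" "subgroup (?C W n) group_of_type" for n
    using subgroup_cotrajectory[OF additive] sg by auto
  have le: "ln (real (group_index U (?C U n))) / real n
      \<le> ln (real ?k) / real n + ln (real (group_index W (?C W n))) / real n" if "n \<ge> 1" for n
  proof -
    have sub: "?C U n \<subseteq> U" "?C W n \<subseteq> W" "?C W n \<subseteq> ?C U n"
      using that cotrajectory_subset cotrajectory_mono[OF \<open>W \<subseteq> U\<close>] by metis+
    note fin = finite_cosets_cotrajectory[OF U W, of n]
    \<comment> \<open>Two factorisations of [U : C_n(W)], through C_n(U) and through W.\<close>
    have eq: "group_index U (?C U n) * group_index (?C U n) (?C W n)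
        = ?k * group_index W (?C W n)"
      using group_index_mult[OF sg(1) sgC sub(3) sub(1) fin]
        group_index_mult[OF sg sgC(2) sub(2) \<open>W \<subseteq> U\<close> fin] by simp
    have pos: "group_index U (?C U n) > 0" "group_index W (?C W n) > 0" "group_index U (?C W n) > 0"
      using group_index_cotrajectory_pos U W by auto
    have "?k * group_index W (?C W n) > 0"
      using group_index_mult[OF sg sgC(2) sub(2) \<open>W \<subseteq> U\<close> fin] pos by simp
    then have "?k > 0" "group_index (?C U n) (?C W n) > 0"
      using eq by (metis gr0I mult_is_0)+
    then have "group_index U (?C U n) \<le> ?k * group_index W (?C W n)"
      by (simp flip: eq)
    then have "real (group_index U (?C U n)) \<le> real ?k * real (group_index W (?C W n))"
      by (simp flip: of_nat_mult)
    then have "ln (real (group_index U (?C U n))) \<le> ln (real ?k * real (group_index W (?C W n)))"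
      using pos by (subst ln_le_cancel_iff) (use \<open>?k > 0\<close> in auto)
    also have "\<dots> = ln (real ?k) + ln (real (group_index W (?C W n)))"
      using pos \<open>?k > 0\<close> by (intro ln_mult_pos) auto
    finally show ?thesis by (simp add: divide_right_mono flip: add_divide_distrib)
  qed
  have "(\<lambda>n. ln (real ?k) / real n) \<longlonglongrightarrow> 0"
    by (rule lim_const_over_n)
  from tendsto_add[OF this H_top_LIMSEQ[OF W]] show ?thesis
    using H_top_LIMSEQ[OF U] le by (intro LIMSEQ_le[of _ _ _ "H_top \<phi> W"]) auto
qed

end

subsection \<open>Finite modules over a finite field\<close>

text \<open>The scalars are a whole type and the multiplicative fields of the record are arbitrary,
  so only the additive group and the scalar action are axiomatised; \<open>vdim\<close> depends on
  nothing else.\<close>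

locale scalar_module = abelian_group M for M :: "('f::field, 'b) module" (structure) +
  assumes smult_closed: "x \<in> carrier M \<Longrightarrow> c \<odot> x \<in> carrier M"
    and smult_l_distr: "x \<in> carrier M \<Longrightarrow> (c + d) \<odot> x = c \<odot> x \<oplus> d \<odot> x"
    and smult_r_distr:
      "x \<in> carrier M \<Longrightarrow> y \<in> carrier M \<Longrightarrow> c \<odot> (x \<oplus> y) = c \<odot> x \<oplus> c \<odot> y"
    and smult_assoc: "x \<in> carrier M \<Longrightarrow> c \<odot> (d \<odot> x) = (c * d) \<odot> x"
    and smult_one: "x \<in> carrier M \<Longrightarrow> 1 \<odot> x = x"
begin

lemma smult_zero_left: "x \<in> carrier M \<Longrightarrow> 0 \<odot> x = \<zero>"
  using smult_l_distr[of x 0 0] smult_closed[of x 0] by simp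

lemma smult_zero_right: "c \<odot> \<zero> = \<zero>"
  using smult_r_distr[of \<zero> \<zero> c] smult_closed[of \<zero> c] by simp

lemma lincomb_closed: "S \<subseteq> carrier M \<Longrightarrow> lincomb M c S \<in> carrier M"
  unfolding lincomb_def by (auto intro!: finsum_closed smult_closed)

lemma lincomb_insert:
  "finite S \<Longrightarrow> x \<notin> S \<Longrightarrow> insert x S \<subseteq> carrier M \<Longrightarrow>
    lincomb M c (insert x S) = c x \<odot> x \<oplus> lincomb M c S"
  unfolding lincomb_def by (subst finsum_insert) (auto intro!: smult_closed)

lemma lincomb_add:
  "S \<subseteq> carrier M \<Longrightarrow> lincomb M (\<lambda>x. c x + d x) S = lincomb M c S \<oplus> lincomb M d S"
  unfolding lincomb_def
  by (subst finsum_addf[symmetric])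
    (auto intro!: finsum_cong' smult_closed simp: smult_l_distr subset_eq)

lemma lincomb_scale:
  assumes "finite S" "S \<subseteq> carrier M"
  shows "lincomb M (\<lambda>x. a * c x) S = a \<odot> lincomb M c S"
  using assms
proof (induction S)
  case empty
  show ?case by (simp add: lincomb_def smult_zero_right)
next
  case (insert x S)
  then show ?case
    by (simp add: lincomb_insert smult_r_distr smult_assoc smult_closed lincomb_closed)
qed

lemma lincomb_cong: "S \<subseteq> carrier M \<Longrightarrow> (\<And>x. x \<in> S \<Longrightarrow> c x = d x) \<Longrightarrow> lincomb M c S = lincomb M d S"
  unfolding lincomb_def by (rule finsum_cong') (auto intro!: smult_closed)

text \<open>\<open>is_basis\<close> lets every vector use its own finite subset of the basis;
  padding with zeros brings all expansions to one index set.\<close>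

lemma lincomb_extend_zero:
  assumes "finite T" "S \<subseteq> T" "T \<subseteq> carrier M"
  shows "lincomb M c S = lincomb M (\<lambda>x. if x \<in> S then c x else 0) T"
  unfolding lincomb_def using assms
  by (intro add.finprod_mono_neutral_cong_left) (auto intro!: smult_closed simp: smult_zero_left)

text \<open>Coefficient families on B correspond bijectively to vectors; the extensional function
  space counts each family once.\<close>

lemma card_carrier_eq_power:
  assumes "is_basis M B" "finite B"
  shows "card (carrier M) = CARD('f) ^ card B"
proof -
  have BM: "B \<subseteq> carrier M"
    and ind: "\<And>c x. lincomb M c B = \<zero> \<Longrightarrow> x \<in> B \<Longrightarrow> c x = 0"
    and span: "\<And>v. v \<in> carrier M \<Longrightarrow> \<exists>S c. finite S \<and> S \<subseteq> B \<and> v = lincomb M c S"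
    using assms by (auto simp: is_basis_def)
  have "bij_betw (\<lambda>c. lincomb M c B) (B \<rightarrow>\<^sub>E (UNIV :: 'f set)) (carrier M)"
    unfolding bij_betw_def
  proof
    show "inj_on (\<lambda>c. lincomb M c B) (B \<rightarrow>\<^sub>E (UNIV :: 'f set))"
    proof (rule inj_onI)
      fix c d :: "'b \<Rightarrow> 'f"
      assume cd: "c \<in> B \<rightarrow>\<^sub>E UNIV" "d \<in> B \<rightarrow>\<^sub>E UNIV" and eq: "lincomb M c B = lincomb M d B"
      \<comment> \<open>Additivity and cancellation stand in for a subtraction rule for
        \<open>lincomb\<close>.\<close>
      have "lincomb M (\<lambda>x. c x - d x) B \<oplus> lincomb M d B = lincomb M c B"
        by (simp add: BM flip: lincomb_add)
      then have "lincomb M (\<lambda>x. c x - d x) B = \<zero>"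
        using lincomb_closed[OF BM] by (metis eq add.r_cancel_one)
      then have "c x = d x" if "x \<in> B" for x using ind[of "\<lambda>x. c x - d x"] that by simp
      then show "c = d" by (rule PiE_ext[OF cd])
    qed
    show "(\<lambda>c. lincomb M c B) ` (B \<rightarrow>\<^sub>E (UNIV :: 'f set)) = carrier M"
    proof (intro equalityI subsetI)
      fix v assume "v \<in> carrier M"
      then obtain S c where "finite S" "S \<subseteq> B" and v: "v = lincomb M c S" using span by blast
      let ?c = "\<lambda>x. if x \<in> S then c x else 0"
      have "v = lincomb M ?c B"
        unfolding v by (rule lincomb_extend_zero[OF assms(2) \<open>S \<subseteq> B\<close> BM])
      also have "\<dots> = lincomb M (restrict ?c B) B" by (intro lincomb_cong BM) auto
      finally show "v \<in> (\<lambda>c. lincomb M c B) ` (B \<rightarrow>\<^sub>E (UNIV :: 'f set))"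
        by (intro rev_image_eqI[of "restrict ?c B"]) auto
    qed (use lincomb_closed[OF BM] in auto)
  qed
  then have "card (carrier M) = card (B \<rightarrow>\<^sub>E (UNIV :: 'f set))"
    by (simp add: bij_betw_same_card)
  then show ?thesis by (simp add: card_PiE assms(2))
qed

text \<open>A finite carrier has finitely many subsets, hence a maximal independent one; a vector
  outside its span could still be added to it.\<close>

lemma basis_exists_finite:
  assumes "finite (carrier M)"
  shows "\<exists>B. is_basis M B"
proof -
  define indep where "indep B \<longleftrightarrow> (\<forall>S c. finite S \<and> S \<subseteq> B \<and> lincomb M c S = \<zero> \<longrightarrow> (\<forall>x\<in>S. c x = 0))" for B
  let ?F = "{B. B \<subseteq> carrier M \<and> indep B}"
  have "finite ?F" using assms by simp
  moreover have "{} \<in> ?F" by (auto simp: indep_def)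
  ultimately have "\<exists>B\<in>?F. \<forall>B'\<in>?F. B \<subseteq> B' \<longrightarrow> B = B'"
    by (intro finite_has_maximal) auto
  then obtain B where B: "B \<in> ?F" and max: "\<And>B'. B' \<in> ?F \<Longrightarrow> B \<subseteq> B' \<Longrightarrow> B = B'"
    by (elim bexE) simp
  have BM: "B \<subseteq> carrier M" and ind: "indep B" using B by auto
  have "\<exists>S c. finite S \<and> S \<subseteq> B \<and> v = lincomb M c S" if v: "v \<in> carrier M" for v
  proof (cases "v \<in> B")
    case True
    have "v = lincomb M (\<lambda>_. 1) {v}"
      using v by (simp add: lincomb_insert smult_one) (simp add: lincomb_def)
    then show ?thesis using True by blast
  next
    case False
    then have "\<not> indep (insert v B)" using max[of "insert v B"] BM v by auto
    then obtain S c x where S: "finite S" "S \<subseteq> insert v B" "lincomb M c S = \<zero>" "x \<in> S" "c x \<noteq> 0"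
      by (auto simp: indep_def)
    define T where "T = S - {v}"
    have T: "finite T" "T \<subseteq> B" "T \<subseteq> carrier M" "v \<notin> T" using S BM by (auto simp: T_def)
    have "v \<in> S" using S ind unfolding indep_def by blast
    then have ST: "S = insert v T" by (auto simp: T_def)
    have 0: "c v \<odot> v \<oplus> lincomb M c T = \<zero>"
      using S(3) T v unfolding ST by (simp add: lincomb_insert)
    \<comment> \<open>Otherwise the relation would live on T \<subseteq> B, and independence would
      force all its coefficients to vanish.\<close>
    have "c v \<noteq> 0"
    proof
      assume "c v = 0"
      then have "lincomb M c T = \<zero>" using 0 v T by (simp add: smult_zero_left lincomb_closed)
      then have "\<forall>x\<in>T. c x = 0" using ind T unfolding indep_def by blast
      then show False using S(4,5) \<open>c v = 0\<close> ST by auto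
    qed
    \<comment> \<open>The relation solved for \<open>v\<close>.\<close>
    define w where "w = lincomb M (\<lambda>x. - inverse (c v) * c x) T"
    have w: "w \<in> carrier M" unfolding w_def by (rule lincomb_closed[OF T(3)])
    have "lincomb M c T \<in> carrier M" by (rule lincomb_closed[OF T(3)])
    then have "\<zero> = inverse (c v) \<odot> (c v \<odot> v) \<oplus> inverse (c v) \<odot> lincomb M c T"
      using 0 v by (metis smult_closed smult_r_distr smult_zero_right)
    also have "inverse (c v) \<odot> (c v \<odot> v) = v"
      using v \<open>c v \<noteq> 0\<close> by (simp add: smult_assoc smult_one)
    also have "inverse (c v) \<odot> lincomb M c T = lincomb M (\<lambda>x. inverse (c v) * c x) T"
      by (simp add: lincomb_scale T)
    finally have "v \<oplus> lincomb M (\<lambda>x. inverse (c v) * c x) T = \<zero>" by simp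
    moreover have "w \<oplus> lincomb M (\<lambda>x. inverse (c v) * c x) T = lincomb M (\<lambda>x. 0 * c x) T"
      unfolding w_def by (simp add: T flip: lincomb_add)
    moreover have "lincomb M (\<lambda>x. 0 * c x) T = \<zero>"
      by (subst lincomb_scale) (use T lincomb_closed in \<open>auto simp: smult_zero_left\<close>)
    \<comment> \<open>Both are additive inverses of the same combination over T.\<close>
    ultimately have "v = w"
      using v w lincomb_closed[OF T(3)] by (metis add.right_cancel)
    then show ?thesis using T unfolding w_def by blast
  qed
  then have "is_basis M B" using BM ind unfolding is_basis_def indep_def by blast
  then show ?thesis ..
qed

lemma card_carrier_eq_power_vdim:
  assumes "finite (carrier M)"
  shows "card (carrier M) = CARD('f) ^ vdim M"
proof -
  define B where "B = (SOME B. is_basis M B)"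
  have B: "is_basis M B" unfolding B_def by (rule someI_ex[OF basis_exists_finite[OF assms]])
  then have "B \<subseteq> carrier M" by (simp add: is_basis_def)
  then have "finite B" using assms finite_subset by blast
  then show ?thesis using card_carrier_eq_power[OF B] by (simp add: vdim_def B_def)
qed

end

subsection \<open>Linear compactness over a finite field\<close>

text \<open>On \<open>A\<close> the map \<open>f\<close> factors through \<open>g\<close>, by
  choosing a representative in each fibre.\<close>

lemma finite_image_if_kernel_subset:
  assumes "finite (g ` A)" and "\<And>x y. x \<in> A \<Longrightarrow> y \<in> A \<Longrightarrow> g x = g y \<Longrightarrow> f x = f y"
  shows "finite (f ` A)"
proof -
  have "f (SOME y. y \<in> A \<and> g y = g x) = f x" if x: "x \<in> A" for x
  proof -
    have "(SOME y. y \<in> A \<and> g y = g x) \<in> A \<and> g (SOME y. y \<in> A \<and> g y = g x) = g x"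
      by (rule someI[of _ x]) (simp add: x)
    then show ?thesis by (elim conjE) (rule assms(2)[OF _ x])
  qed
  then have "f ` A = (\<lambda>z. f (SOME y. y \<in> A \<and> g y = z)) ` g ` A" by (simp add: image_image)
  then show ?thesis using assms(1) by simp
qed

text \<open>The complement is the union of the other cosets, all of them open.\<close>

lemma closed_coset:
  fixes W :: "'a::topological_ab_group_add set"
  assumes "open W" and W: "subgroup W group_of_type"
  shows "closed ((+) x ` W)"
proof -
  have "0 \<in> W" using W by (simp add: subgroup_group_of_type_iff)
  then have self: "y \<in> (+) y ` W" for y using imageI[of 0 W "(+) y"] by simp
  have mem: "(+) z ` W = (+) y ` W" if "z \<in> (+) y ` W" for y z
    unfolding coset_eq_iff[OF W] using that by auto
  have eq: "(+) y ` W = (+) x ` W" if "z \<in> (+) y ` W" "z \<in> (+) x ` W" for y z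
    using mem[OF that(1)] mem[OF that(2)] by simp
  have "- ((+) x ` W) = (\<Union>y\<in>- ((+) x ` W). (+) y ` W)"
  proof (intro equalityI subsetI)
    fix z assume "z \<in> (\<Union>y\<in>- ((+) x ` W). (+) y ` W)"
    then obtain y where y: "y \<notin> (+) x ` W" "z \<in> (+) y ` W" by (elim UN_E) simp
    show "z \<in> - ((+) x ` W)"
    proof
      assume "z \<in> (+) x ` W"
      from eq[OF y(2) this] show False using self[of y] y(1) by simp
    qed
  qed (rule UN_I, assumption, rule self)
  then have "open (- ((+) x ` W))" using open_UN[of "- ((+) x ` W)" "\<lambda>y. (+) y ` W"] open_coset[OF \<open>open W\<close>] by simp
  then show ?thesis by (simp add: closed_def)
qed

lemma open_subgroup_supset:
  fixes W :: "'a::topological_ab_group_add set"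
  assumes "open W" "0 \<in> W" "W \<subseteq> S" and S: "subgroup S group_of_type"
  shows "open S"
proof -
  have "x + w \<in> S" if "x \<in> S" "w \<in> W" for x w
  proof -
    have "x - (0 - w) \<in> S" using that assms(3) S unfolding subgroup_group_of_type_iff by blast
    then show ?thesis by simp
  qed
  then have "(\<Union>x\<in>S. (+) x ` W) \<subseteq> S" by auto
  moreover have "x \<in> (+) x ` W" for x using imageI[OF \<open>0 \<in> W\<close>, of "(+) x"] by simp
  then have "S \<subseteq> (\<Union>x\<in>S. (+) x ` W)" by (intro subsetI UN_I)
  ultimately have "S = (\<Union>x\<in>S. (+) x ` W)" by (rule equalityI[rotated])
  then show ?thesis
    using open_UN[of S "\<lambda>x. (+) x ` W"] open_coset[OF \<open>open W\<close>] by simp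
qed

context topological_vector_space
begin

lemma subgroup_subspace: "subspace W \<Longrightarrow> subgroup W group_of_type"
  by (simp add: subgroup_group_of_type_iff subspace_0 subspace_diff)

lemma linearly_compactD:
  assumes "linearly_compact W" "\<And>A. A \<in> \<C> \<Longrightarrow> closed_linear_variety W A"
    and "\<And>\<F>. finite \<F> \<Longrightarrow> \<F> \<subseteq> \<C> \<Longrightarrow> \<Inter>\<F> \<noteq> {}"
  shows "\<Inter>\<C> \<noteq> {}"
proof -
  have "(\<forall>A\<in>\<C>. closed_linear_variety W A) \<and>
      (\<forall>\<F>. finite \<F> \<and> \<F> \<subseteq> \<C> \<longrightarrow> \<Inter>\<F> \<noteq> {})"
  proof (intro conjI ballI allI impI)
    show "closed_linear_variety W A" if "A \<in> \<C>" for A by (rule assms(2)[OF that])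
    show "\<Inter>\<F> \<noteq> {}" if "finite \<F> \<and> \<F> \<subseteq> \<C>" for \<F>
      using that by (elim conjE) (rule assms(3))
  qed
  then show ?thesis
    by (rule conjunct2[OF assms(1)[unfolded linearly_compact_def], THEN spec, THEN mp])
qed

text \<open>For a basis vector b of U outside a basis of W, the vectors with b-coordinate 1 form a
  closed linear variety. Linear compactness gives a point common to all of these, so there are
  finitely many such b. Over a finite field their coordinates take finitely many values, and these
  determine the coset modulo W.\<close>

lemma finite_cosets_open_subspace:
  assumes fin: "finite (UNIV :: 'f set)"
    and U: "linearly_compact U" "subspace U"
    and W: "subspace W" "open W" "W \<subseteq> U"
  shows "finite ((\<lambda>x. (+) x ` W) ` U)"
proof -
  obtain B0 where B0: "B0 \<subseteq> W" "independent B0" "W \<subseteq> span B0"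
    using maximal_independent_subset by blast
  obtain B where B: "B0 \<subseteq> B" "B \<subseteq> U" "independent B" "U \<subseteq> span B"
    by (rule maximal_independent_subset_extend[OF order_trans[OF B0(1) W(3)] B0(2)])
  let ?r = "representation B"
  let ?E = "B - B0"
  define S where "S b = {v\<in>U. ?r v b = 0}" for b
  define A where "A b = {v\<in>U. ?r v b = 1}" for b
  have span: "v \<in> span B" if "v \<in> U" for v using that B(4) by (rule rev_subsetD)
  have sub: "subspace (S b)" for b
    by (rule subspaceI) (simp_all add: S_def representation_zero representation_add
        representation_scale B(3) span subspace_0 subspace_add subspace_scale U(2))
  have "?r w b = 0" if w: "w \<in> W" "b \<in> ?E" for w b
  proof -
    have "w \<in> span B0" using w B0 by blast
    then have "?r w = representation B0 w" by (rule representation_extend[OF B(3) _ B(1)])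
    moreover have "representation B0 w b = 0" using representation_ne_zero[of B0 w b] w by blast
    ultimately show ?thesis by simp
  qed
  then have WS: "W \<subseteq> S b" if "b \<in> ?E" for b
    using that W(3) by (simp add: S_def subset_eq)
  \<comment> \<open>Containing the open W makes the kernel of the coordinate open, hence closed, so
    that \<open>A b\<close> is an admissible variety.\<close>
  have "open (S b)" if "b \<in> ?E" for b
    using open_subgroup_supset[OF W(2) subspace_0[OF W(1)] WS[OF that] subgroup_subspace[OF sub]] .
  then have cl: "closed (S b)" if "b \<in> ?E" for b
    using closed_coset[OF _ subgroup_subspace[OF sub], of b 0] that by simp
  have AS: "A b = (+) b ` S b" if "b \<in> ?E" for b
  proof -
    have b: "b \<in> U" "?r b b = 1"
      using that B(2,3) by (auto simp: representation_basis)
    show ?thesis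
    proof (intro equalityI subsetI)
      fix v assume "v \<in> A b"
      then have "v - b \<in> S b"
        using b by (simp add: A_def S_def representation_diff B(3) span subspace_diff U(2))
      then have "b + (v - b) \<in> (+) b ` S b" by (rule imageI)
      then show "v \<in> (+) b ` S b" by simp
    next
      fix v assume "v \<in> (+) b ` S b"
      then obtain u where "u \<in> S b" "v = b + u" by (elim imageE)
      then show "v \<in> A b"
        using b by (simp add: A_def S_def representation_add B(3) span subspace_add U(2))
    qed
  qed
  have var: "\<forall>Z\<in>A ` ?E. closed_linear_variety U Z"
  proof clarify
    fix b assume b: "b \<in> B" "b \<notin> B0"
    have "closedin (top_of_set U) (S b)"
      using cl b by (auto simp: closedin_closed S_def intro!: exI[of _ "S b"])
    moreover have "S b \<subseteq> U" by (auto simp: S_def)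
    moreover have "b \<in> U" "A b = (+) b ` S b" using b B(2) AS[of b] by auto
    ultimately show "closed_linear_variety U (A b)"
      unfolding closed_linear_variety_def using sub[of b] by metis
  qed
  have fip: "\<Inter>\<F> \<noteq> {}" if "finite \<F>" "\<F> \<subseteq> A ` ?E" for \<F>
  proof -
    obtain E where E: "E \<subseteq> ?E" "finite E" "\<F> = A ` E"
      using finite_subset_image[OF \<open>finite \<F>\<close> \<open>\<F> \<subseteq> A ` ?E\<close>] by auto
    \<comment> \<open>The sum of the finitely many basis vectors involved is the common
      point.\<close>
    have "?r (\<Sum>e\<in>E. e) b = 1" if "b \<in> E" for b
    proof -
      have "?r (\<Sum>e\<in>E. e) b = (\<Sum>e\<in>E. ?r e b)"
        using E(1) B(3) by (subst representation_sum) (auto intro: span_base)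
      also have "\<dots> = (\<Sum>e\<in>E. if e = b then 1 else 0)"
        using E(1) B(3) by (intro sum.cong) (auto simp: representation_basis)
      finally show ?thesis using E(2) that by simp
    qed
    moreover have "(\<Sum>e\<in>E. e) \<in> U" using E(1) B(2) by (intro subspace_sum U(2)) auto
    ultimately have "(\<Sum>e\<in>E. e) \<in> \<Inter>\<F>" by (simp add: E(3) A_def)
    then show ?thesis by (metis empty_iff)
  qed
  have "\<Inter>(A ` ?E) \<noteq> {}"
    by (rule linearly_compactD[OF U(1) bspec[OF var] fip])
  then obtain v where "\<And>b. b \<in> ?E \<Longrightarrow> ?r v b = 1" by (auto simp: A_def)
  \<comment> \<open>All of \<open>?E\<close> lies in the support of the single vector
    \<open>v\<close>.\<close>
  then have "?E \<subseteq> {b. ?r v b \<noteq> 0}" by force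
  then have finE: "finite ?E" by (rule finite_subset) (rule finite_representation)
  \<comment> \<open>If x and y agree in the coordinates from \<open>?E\<close>, then x - y is
    supported on B0 and so lies in W.\<close>
  show ?thesis
  proof (rule finite_image_if_kernel_subset)
    show "finite ((\<lambda>u. restrict (?r u) ?E) ` U)"
      by (rule finite_subset[OF image_subsetI finite_PiE[OF finE fin]]) (simp add: restrict_PiE_iff)
    fix x y assume xy: "x \<in> U" "y \<in> U" and eq: "restrict (?r x) ?E = restrict (?r y) ?E"
    have "?r x b = ?r y b" if "b \<in> ?E" for b
      using fun_cong[OF eq, of b] that by simp
    then have "?r (x - y) b = 0" if "b \<in> ?E" for b
      using that xy by (simp add: representation_diff B(3) span)
    then have "{b. ?r (x - y) b \<noteq> 0} \<subseteq> B0"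
      using representation_ne_zero[of B "x - y"] by blast
    then have "(\<Sum>b | ?r (x - y) b \<noteq> 0. scale (?r (x - y) b) b) \<in> W"
      using B0(1) by (intro subspace_sum subspace_scale W(1)) auto
    also have "(\<Sum>b | ?r (x - y) b \<noteq> 0. scale (?r (x - y) b) b) = x - y"
      by (intro sum_nonzero_representation_eq B(3) span_diff span xy)
    finally show "(+) x ` W = (+) y ` W"
      unfolding coset_eq_iff[OF subgroup_subspace[OF W(1)]] .
  qed
qed

section \<open>Quotient spaces and their cardinality\<close>

lemma carrier_quotient_space:
  "carrier (quotient_space U W) = (\<lambda>x. (+) x ` W) ` U"
  by (simp add: quotient_space_def Let_def FactGroup_def rcosets_group_of_type)

text \<open>Sum and scalar multiple of cosets are computed on representatives, after which every
  axiom is inherited from the ambient space.\<close>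

lemma scalar_module_quotient_space:
  assumes "subspace U" "subspace W" "W \<subseteq> U"
  shows "scalar_module (quotient_space U W)"
proof -
  define q where "q x = (+) x ` W" for x
  let ?Q = "quotient_space U W"
  have W0: "0 \<in> W" using assms by (simp add: subspace_0)
  have carrier: "carrier ?Q = q ` U" by (simp add: carrier_quotient_space q_def[abs_def])
  have zero: "\<zero>\<^bsub>?Q\<^esub> = q 0" by (simp add: quotient_space_def Let_def FactGroup_def q_def)
  have add: "q x \<oplus>\<^bsub>?Q\<^esub> q y = q (x + y)" for x y
  proof -
    have "q x \<oplus>\<^bsub>?Q\<^esub> q y = {(x + v) + (y + w) | v w. v \<in> W \<and> w \<in> W}"
      by (auto simp: quotient_space_def Let_def FactGroup_def set_mult_def group_of_type_def q_def)
    also have "\<dots> = q (x + y)"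
    proof (intro equalityI subsetI)
      fix z assume "z \<in> q (x + y)"
      then obtain w where "w \<in> W" "z = (x + 0) + (y + w)" by (auto simp: q_def algebra_simps)
      then show "z \<in> {(x + v) + (y + w) | v w. v \<in> W \<and> w \<in> W}" using W0 by blast
    next
      fix z assume "z \<in> {(x + v) + (y + w) | v w. v \<in> W \<and> w \<in> W}"
      then obtain v w where "v \<in> W" "w \<in> W" "z = (x + v) + (y + w)" by blast
      then have "v + w \<in> W" "z = (x + y) + (v + w)"
        using assms by (auto simp: subspace_add algebra_simps)
      then show "z \<in> q (x + y)" by (auto simp: q_def)
    qed
    finally show ?thesis .
  qed
  have smult: "c \<odot>\<^bsub>?Q\<^esub> q x = q (scale c x)" for c x
  proof -
    have "c \<odot>\<^bsub>?Q\<^esub> q x = {scale c (x + v) + w | v w. v \<in> W \<and> w \<in> W}"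
      by (auto simp: quotient_space_def Let_def q_def)
    also have "\<dots> = q (scale c x)"
    proof (intro equalityI subsetI)
      fix z assume "z \<in> q (scale c x)"
      then obtain w where "w \<in> W" "z = scale c (x + 0) + w" by (auto simp: q_def)
      then show "z \<in> {scale c (x + v) + w | v w. v \<in> W \<and> w \<in> W}" using W0 by blast
    next
      fix z assume "z \<in> {scale c (x + v) + w | v w. v \<in> W \<and> w \<in> W}"
      then obtain v w where "v \<in> W" "w \<in> W" "z = scale c (x + v) + w" by blast
      then have "scale c v + w \<in> W" "z = scale c x + (scale c v + w)"
        using assms by (auto simp: subspace_add subspace_scale scale_right_distrib algebra_simps)
      then show "z \<in> q (scale c x)" by (auto simp: q_def)
    qed
    finally show ?thesis .
  qed
  have "abelian_group ?Q"
  proof (rule abelian_groupI)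
    show "\<exists>y\<in>carrier ?Q. y \<oplus>\<^bsub>?Q\<^esub> x = \<zero>\<^bsub>?Q\<^esub>" if "x \<in> carrier ?Q" for x
    proof -
      obtain u where "u \<in> U" "x = q u" using \<open>x \<in> carrier ?Q\<close> unfolding carrier by (rule imageE)
      then show ?thesis
        using assms subspace_neg[of U u] by (auto simp: carrier add zero intro!: bexI[of _ "- u"])
    qed
  qed (use assms in \<open>auto simp: carrier add zero subspace_0 subspace_add add.assoc
        add.commute[of "_ :: 'v"] add.left_commute[of "_ :: 'v"]
        intro!: imageI\<close>)
  then show ?thesis
    unfolding scalar_module_def scalar_module_axioms_def
    using assms by (auto simp: carrier add smult subspace_scale scale_left_distrib
        scale_right_distrib)
qed

lemma group_index_eq_power_vdim:
  assumes "subspace U" "subspace W" "W \<subseteq> U" "finite ((\<lambda>x. (+) x ` W) ` U)"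
  shows "group_index U W = CARD('f) ^ vdim (quotient_space U W)"
  using scalar_module.card_carrier_eq_power_vdim[OF scalar_module_quotient_space[OF assms(1-3)]]
    assms(4) by (simp add: carrier_quotient_space group_index_eq_card_image)

end

section \<open>From linear compactness to compactness\<close>

context locally_linearly_compact_space
begin

lemma B_lin_base:
  assumes "open N" "0 \<in> N"
  obtains K where "K \<in> B_lin" "K \<subseteq> N"
  using linearly_compact_base assms unfolding neighbourhood_base_at_def by (metis open_openin)

text \<open>The complements of the open linear varieties form a subbase, since over a finite field an
  open linear variety is the complement of the finitely many other cosets. Linear compactness is
  the hypothesis of Alexander's subbase theorem for it.\<close>

lemma compact_if_linearly_compact:
  assumes fin: "finite (UNIV :: 'a set)" and U: "U \<in> B_lin"
  shows "compact U"
proof -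
  have lc: "linearly_compact U" and sU: "subspace U" and oU: "open U"
    using U by (auto simp: B_lin_def)
  \<comment> \<open>U is inserted so that the family covers U: for U = {0} the complements alone are
    all empty.\<close>
  define \<B> where
    "\<B> = insert U {U - (+) v ` S | v S. v \<in> U \<and> subspace S \<and> open S \<and> S \<subseteq> U}"
  have "compact_space (top_of_set U)"
  proof (rule Alexander_subbase_alt[of U \<B>])
    show "U \<subseteq> \<Union>\<B>" by (auto simp: \<B>_def)
  next
    fix C assume C: "C \<subseteq> \<B>" "U \<subseteq> \<Union>C"
    show "\<exists>C'. finite C' \<and> C' \<subseteq> C \<and> U \<subseteq> \<Union>C'"
    proof (cases "U \<in> C")
      case True
      then show ?thesis by (intro exI[of _ "{U}"]) auto
    next
      case False
      \<comment> \<open>The varieties whose complements belong to the cover. That C covers U means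
        that they have no common point, and linear compactness finds finitely many that already have
        none.\<close>
      define \<D> where "\<D> = {A. closed_linear_variety U A \<and> A \<subseteq> U \<and> U - A \<in> C}"
      have rep: "\<exists>A\<in>\<D>. Z = U - A" if "Z \<in> C" for Z
      proof -
        have "Z \<in> \<B>" "Z \<noteq> U" using \<open>Z \<in> C\<close> C False by auto
        then obtain v S where vS: "Z = U - (+) v ` S" "v \<in> U" "subspace S" "open S" "S \<subseteq> U"
          unfolding \<B>_def by blast
        have "closed S" using closed_coset[OF vS(4) subgroup_subspace[OF vS(3)], of 0] by simp
        then have "closedin (top_of_set U) S"
          using vS(5) by (auto simp: closedin_closed)
        moreover have "(+) v ` S \<subseteq> U" using vS sU by (auto intro: subspace_add)
        ultimately have "closed_linear_variety U ((+) v ` S)" "(+) v ` S \<subseteq> U"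
          using vS unfolding closed_linear_variety_def by blast+
        then have "(+) v ` S \<in> \<D>" using that vS(1) by (simp add: \<D>_def)
        then show ?thesis using vS(1) by (rule bexI[rotated])
      qed
      have "\<Inter>\<D> = {}"
      proof (rule ccontr)
        assume "\<Inter>\<D> \<noteq> {}"
        then obtain x where x: "\<And>A. A \<in> \<D> \<Longrightarrow> x \<in> A" by blast
        \<comment> \<open>The intersection of an empty family is \<open>UNIV\<close>, so a member of
          \<D> is needed to place x inside U; the cover is nonempty since it reaches 0.\<close>
        obtain Z where "Z \<in> C" using C subspace_0[OF sU] by blast
        then obtain A where "A \<in> \<D>" using rep[of Z] by auto
        then have "x \<in> U" using x by (auto simp: \<D>_def)
        then obtain Z' where "Z' \<in> C" "x \<in> Z'" using C by blast
        moreover obtain A where "A \<in> \<D>" "Z' = U - A" using rep[OF \<open>Z' \<in> C\<close>] by auto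
        ultimately show False using x[of A] by simp
      qed
      have "\<exists>\<F>. finite \<F> \<and> \<F> \<subseteq> \<D> \<and> \<Inter>\<F> = {}"
      proof (rule ccontr)
        assume no: "\<not> ?thesis"
        have "\<Inter>\<D> \<noteq> {}"
        proof (rule linearly_compactD[OF lc])
          fix \<F> assume "finite \<F>" "\<F> \<subseteq> \<D>"
          then show "\<Inter>\<F> \<noteq> {}" using no by metis
        qed (simp add: \<D>_def)
        then show False using \<open>\<Inter>\<D> = {}\<close> by (rule notE)
      qed
      then obtain \<F> where \<F>: "finite \<F>" "\<F> \<subseteq> \<D>" "\<Inter>\<F> = {}" by (elim exE conjE)
      show ?thesis
        using \<F> by (intro exI[of _ "(\<lambda>A. U - A) ` \<F>"]) (auto simp: \<D>_def)
    qed
  next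
    show "topology (arbitrary union_of (finite intersection_of (\<lambda>x. x \<in> \<B>) relative_to U))
        = top_of_set U"
    proof (rule topology_base_unique)
      fix Z assume "(finite intersection_of (\<lambda>x. x \<in> \<B>) relative_to U) Z"
      then obtain \<U> where \<U>: "finite \<U>" "\<U> \<subseteq> \<B>" "Z = U \<inter> \<Inter>\<U>"
        by (auto simp: relative_to_def intersection_of_def)
      have "open Y" if "Y \<in> \<B>" for Y
        using that oU closed_coset[OF _ subgroup_subspace] by (auto simp: \<B>_def intro!: open_Diff)
      then have "open Z" using \<U> oU by (auto intro!: open_Int open_Inter)
      then show "openin (top_of_set U) Z" using \<U> oU by (simp add: openin_open_eq)
    next
      fix T x assume T: "openin (top_of_set U) T" "x \<in> T"
      then have "open T" "T \<subseteq> U" using oU by (auto simp: openin_open_eq)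
      \<comment> \<open>T moved back to the origin and cut down to U, so that a basic K \<subseteq>
        N satisfies both x + K \<subseteq> T and K \<subseteq> U.\<close>
      define N where "N = (\<lambda>z. x + z) -` T \<inter> U"
      have "open N" unfolding N_def
        by (intro open_Int open_vimage \<open>open T\<close> oU continuous_intros)
      moreover have "0 \<in> N" using T subspace_0[OF sU] by (simp add: N_def)
      ultimately obtain K where K: "K \<in> B_lin" "K \<subseteq> N" by (rule B_lin_base)
      have sK: "subspace K" "open K" and KU: "K \<subseteq> U"
        using K by (auto simp: B_lin_def N_def)
      define q where "q z = (+) z ` K" for z
      have q_eq: "q y = q z \<longleftrightarrow> y - z \<in> K" for y z
        unfolding q_def by (rule coset_eq_iff[OF subgroup_subspace[OF sK(1)]])
      have qU: "q z \<subseteq> U" if "z \<in> U" for z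
        using that sU KU by (auto simp: q_def intro: subspace_add)
      have self: "z \<in> q z" for z using subspace_0[OF sK(1)] by (force simp: q_def)
      have qeq: "q y = q z" if "y \<in> q z" for y z
        using that by (auto simp: q_eq) (auto simp: q_def)
      let ?\<U> = "(\<lambda>A. U - A) ` (q ` U - {q x})"
      have xU: "x \<in> U" using T \<open>T \<subseteq> U\<close> by blast
      have "finite ?\<U>"
        using finite_cosets_open_subspace[OF fin lc sU sK KU] by (simp add: q_def[abs_def])
      moreover have "?\<U> \<subseteq> \<B>" using sK KU by (auto simp: \<B>_def q_def)
      \<comment> \<open>For K = U there are no other cosets and the intersection over them is
        \<open>UNIV\<close>; the factor U covers this case.\<close>
      moreover have "U \<inter> \<Inter>?\<U> = q x"
      proof (intro equalityI subsetI)
        fix y assume y: "y \<in> U \<inter> \<Inter>?\<U>"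
        show "y \<in> q x"
        proof (rule ccontr)
          assume "y \<notin> q x"
          then have "q y \<noteq> q x" using self[of y] by auto
          then have "U - q y \<in> ?\<U>" using y by auto
          moreover have "y \<in> \<Inter>?\<U>" using y by (rule IntD2)
          ultimately have "y \<in> U - q y" by (rule InterD[rotated])
          then show False using self[of y] by simp
        qed
      next
        fix y assume y: "y \<in> q x"
        then have yU: "y \<in> U" using qU[OF xU] by (rule rev_subsetD)
        have "y \<notin> q z" if "q z \<noteq> q x" for z
          using qeq[OF y] qeq[of y z] that by argo
        then show "y \<in> U \<inter> \<Inter>?\<U>" using yU by (intro IntI InterI) auto
      qed
      ultimately have "(finite intersection_of (\<lambda>x. x \<in> \<B>) relative_to U) (q x)"
        unfolding relative_to_def intersection_of_def
        by (intro exI[of _ "\<Inter>?\<U>"] conjI exI[of _ ?\<U>] refl) (simp_all only: subset_eq mem_Collect_eq)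
      moreover have "q x \<subseteq> T" using K by (auto simp: q_def N_def)
      ultimately show "\<exists>B. (finite intersection_of (\<lambda>x. x \<in> \<B>) relative_to U) B \<and> x \<in> B \<and> B \<subseteq> T"
        using self by (intro exI[of _ "q x"]) simp
    qed
  qed
  then show ?thesis
    by (simp add: compact_space_subtopology compactin_subspace flip: compactin_euclidean_iff)
qed

section \<open>The two entropies at a linearly compact open subspace\<close>

lemma B_lin_subset_B_gr: "finite (UNIV :: 'a set) \<Longrightarrow> B_lin \<subseteq> B_gr"
  using compact_if_linearly_compact by (auto simp: B_gr_def B_lin_def subgroup_subspace)

text \<open>The limit in \<open>H_star\<close> is shown to exist here: dividing the convergent
  logarithmic averages of the indices by ln |F| gives the averages of the dimensions.\<close>

lemma H_top_eq_H_star: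
  assumes fin: "finite (UNIV :: 'a set)" and lin: "Vector_Spaces.linear scale scale \<phi>"
    and cont: "continuous_on UNIV \<phi>" and U: "U \<in> B_lin"
  shows "H_top \<phi> U = H_star \<phi> U * ln (real CARD('a))"
proof -
  interpret \<phi>: Vector_Spaces.linear scale scale \<phi> by fact
  have add: "Modules.additive \<phi>" by unfold_locales (rule \<phi>.add)
  have sU: "subspace U" using U by (simp add: B_lin_def)
  have Ugr: "U \<in> B_gr" using B_lin_subset_B_gr[OF fin] U by blast
  have sC: "subspace (cotrajectory \<phi> U n)" for n
  proof (induction n)
    case 0
    show ?case by (simp add: cotrajectory_def)
  next
    case (Suc n)
    then show ?case
      unfolding cotrajectory_Suc' by (intro subspace_inter sU \<phi>.subspace_vimage)
  qed
  let ?d = "\<lambda>n. vdim (quotient_space U (cotrajectory \<phi> U n))"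
  \<comment> \<open>A field has 0 \<noteq> 1, so ln |F| is positive and may be divided by.\<close>
  have "card {0, 1 :: 'a} \<le> CARD('a)" by (rule card_mono[OF fin]) simp
  then have card2: "CARD('a) \<ge> 2" by simp
  then have pos: "ln (real CARD('a)) > 0" by (intro ln_gt_zero) linarith
  have idx: "ln (real (group_index U (cotrajectory \<phi> U n))) = real (?d n) * ln (real CARD('a))"
    if "n \<ge> 1" for n
    using group_index_eq_power_vdim[OF sU sC cotrajectory_subset[OF that]
        finite_cosets_cotrajectory[OF add cont Ugr Ugr]] card2
    by (simp add: ln_realpow)
  have "(\<lambda>n. ln (real (group_index U (cotrajectory \<phi> U n))) / real n / ln (real CARD('a)))
      \<longlonglongrightarrow> H_top \<phi> U / ln (real CARD('a))"
    using pos by (intro tendsto_divide H_top_LIMSEQ[OF add cont Ugr] tendsto_const) simp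
  moreover have "\<forall>\<^sub>F n in sequentially. ln (real (group_index U (cotrajectory \<phi> U n))) / real n
      / ln (real CARD('a)) = real (?d n) / real n"
    using eventually_ge_at_top[of 1] by eventually_elim (use pos in \<open>simp add: idx\<close>)
  ultimately have "(\<lambda>n. real (?d n) / real n) \<longlonglongrightarrow> H_top \<phi> U / ln (real CARD('a))"
    by (rule Lim_transform_eventually)
  then have "H_star \<phi> U = H_top \<phi> U / ln (real CARD('a))"
    unfolding H_star_def by (rule limI)
  then show ?thesis using pos by simp
qed

end

theorem proposition3p9:
  fixes scale :: "'f::{field, finite} \<Rightarrow> 'v::topological_ab_group_add \<Rightarrow> 'v"
    and \<phi> :: "'v \<Rightarrow> 'v"
  assumes "locally_linearly_compact_space scale"
    and "Vector_Spaces.linear scale scale \<phi>"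
    and "continuous_on UNIV \<phi>"
  shows "h_top \<phi> = topological_vector_space.ent_star scale \<phi> * ereal (ln (real CARD('f)))"
proof -
  interpret locally_linearly_compact_space scale by fact
  interpret \<phi>: Vector_Spaces.linear scale scale \<phi> by fact
  have add: "Modules.additive \<phi>" by unfold_locales (rule \<phi>.add)
  have fin: "finite (UNIV :: 'f set)" by simp
  have "h_top \<phi> = (SUP U\<in>B_lin. ereal (H_top \<phi> U))"
    unfolding h_top_def
  proof (rule SUP_eq)
    fix U :: "'v set" assume U: "U \<in> B_gr"
    then obtain K where K: "K \<in> B_lin" "K \<subseteq> U"
      using B_lin_base[of U] by (auto simp: B_gr_def subgroup_group_of_type_iff)
    then have "H_top \<phi> U \<le> H_top \<phi> K"
      using H_top_antimono[OF add assms(3) U] B_lin_subset_B_gr[OF fin] by blast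
    then show "\<exists>K\<in>B_lin. ereal (H_top \<phi> U) \<le> ereal (H_top \<phi> K)" using K by auto
  qed (use B_lin_subset_B_gr[OF fin] in auto)
  also have "\<dots> = (SUP U\<in>B_lin. ereal (H_star \<phi> U) * ereal (ln (real CARD('f))))"
    using H_top_eq_H_star[OF fin assms(2,3)] by (intro SUP_cong) auto
  \<comment> \<open>The supremum may be infinite; a nonnegative real factor still passes through it
    in \<open>ereal\<close>, given a nonempty index set.\<close>
  also have "\<dots> = ent_star \<phi> * ereal (ln (real CARD('f)))"
    unfolding ent_star_def
  proof (rule Sup_ereal_mult_right'[symmetric])
    show "B_lin \<noteq> {}" using B_lin_base[of UNIV] by blast
    show "0 \<le> ln (real CARD('f))" using zero_less_card_finite[where 'a='f] by simp
  qed
  finally show ?thesis .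
qed

end
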